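(* Let $q,b,z_d\in\mathbb{R}$ with $q\neq0$, and $M_1>0$. Let $u_{g_{op}}$ be the solution of $(S)$ for $g=g_{op}$, the minimizer of $J_1$ over $\mathbb{R}$, and for $h=x_0/n$ let $u^h_{g^h_{op}}$ be the discrete solution for $g=g^h_{op}$, the minimizer of $J^h_1$ over $\mathbb{R}$. Then there are positive constants $C_5,C_6$ independent of $h$ such that, as $h\to0$ ($h=x_0/n$, $n\to\infty$), $$\text{(a)}\quad \|u_{g_{op}}-u^h_{g^h_{op}}\|_H=C_5h+o(h),\qquad \text{(b)}\quad \left\|\frac{\partial u_{g_{op}}}{\partial x}-\frac{\partial u^h_{g^h_{op}}}{\partial x}\right\|_H=C_6h+o(h).$$
   Context: Fix $x_0,y_0>0$, $\Omega=(0,x_0)\times(0,y_0)$ and $H=L^2(\Omega)$ with its standard norm. For constants $g,q,b\in\mathbb{R}$, system $(S)$: $-\Delta u=g$ in $\Omega$, $u=b$ on $\{0\}\times(0,y_0]$, $-\partial u/\partial n=q$ on $\{x_0\}\times(0,y_0]$, $-\partial u/\partial n=0$ on $[0,x_0]\times\{0,y_0\}$, has solution $u_g(x,y)=-\tfrac12gx^2+(gx_0-q)x+b$. For an integer $n\ge1$, $h=x_0/n$, $x_i=(i-1)h$, its discrete (finite-difference, piecewise linear) approximation is $u^h_g(x,y)=(gx_0-q-hgi)x+h^2g\tfrac{i(i-1)}2+b$ for $x\in[x_i,x_{i+1}]$, $y\in[0,y_0]$, $i=1,\dots,n$ (its $x$-derivative is piecewise constant, defined a.e.). For fixed $q,b,z_d\in\mathbb{R}$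 and $M_1>0$ the cost functions on $\mathbb{R}$ are $J_1(g)=\tfrac12\|u_g-z_d\|_H^2+\tfrac{M_1}2\|g\|_H^2$ and $J^h_1(g)=\tfrac12\|u^h_g-z_d\|_H^2+\tfrac{M_1}2\|g\|_H^2$, where constants are viewed as constant functions on $\Omega$. With $A_1=\tfrac58-\tfrac{b-z_d}{qx_0}$, $A_2=\tfrac{3(b-z_d)}{4qx_0}-\tfrac12$, $A_3=\tfrac{b-z_d}{4qx_0}-\tfrac18$, $A_4=\tfrac2{15}+\tfrac{M_1}{x_0^4}$, $A_5(h)=\tfrac h{12x_0}\left(\tfrac{h^3}{15x_0^3}+\tfrac{h^2}{2x_0^2}+\tfrac h{3x_0}-\tfrac52\right)$, the minimizers are $g_{op}=\frac q{3x_0}\frac{A_1}{A_4}$ and $g^h_{op}=\frac{q}{3x_0}\frac{A_1+\frac h{x_0}A_2+\frac{h^2}{x_0^2}A_3}{A_4+A_5(h)}$. *)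

theory Defs
  imports "HOL-Analysis.Analysis" "HOL-Library.Landau_Symbols"
begin

definition Omega :: "real \<Rightarrow> real \<Rightarrow> (real \<times> real) set" where
  "Omega x0 y0 = {0<..<x0} \<times> {0<..<y0}"

definition H_norm :: "real \<Rightarrow> real \<Rightarrow> (real \<times> real \<Rightarrow> real) \<Rightarrow> real" where
  "H_norm x0 y0 f = sqrt (LINT p:Omega x0 y0|lborel. (f p)\<^sup>2)"

definition partial_x :: "(real \<times> real \<Rightarrow> real) \<Rightarrow> real \<times> real \<Rightarrow> real" where
  "partial_x u = (\<lambda>(x, y). deriv (\<lambda>t. u (t, y)) x)"

text \<open>
  Classical solutions of \<open>-\<Delta>u = g\<close> in \<open>\<Omega>\<close> with \<open>u = b\<close> on \<open>{0} \<times> (0,y0]\<close>, \<open>-\<partial>u/\<partial>n = q\<close>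
  on \<open>{x0} \<times> (0,y0]\<close> and \<open>-\<partial>u/\<partial>n = 0\<close> on \<open>[0,x0] \<times> {0,y0}\<close>. The function is \<open>C\<^sup>1\<close> up to the
  boundary (one-sided derivatives there) and has pure second partial derivatives in \<open>\<Omega>\<close>.
  The outward normal derivative is \<open>u\<^sub>x\<close> at \<open>x = x0\<close>, \<open>u\<^sub>y\<close> at \<open>y = y0\<close> and \<open>-u\<^sub>y\<close> at \<open>y = 0\<close>.
\<close>
definition solves_S ::
  "real \<Rightarrow> real \<Rightarrow> real \<Rightarrow> real \<Rightarrow> real \<Rightarrow> (real \<times> real \<Rightarrow> real) \<Rightarrow> bool" where
  "solves_S x0 y0 q b g u \<longleftrightarrow>
    (\<exists>ux uy uxx uyy.
      continuous_on ({0..x0} \<times> {0..y0}) u \<and>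
      continuous_on ({0..x0} \<times> {0..y0}) ux \<and>
      continuous_on ({0..x0} \<times> {0..y0}) uy \<and>
      (\<forall>x\<in>{0..x0}. \<forall>y\<in>{0..y0}.
        ((\<lambda>t. u (t, y)) has_real_derivative ux (x, y)) (at x within {0..x0}) \<and>
        ((\<lambda>t. u (x, t)) has_real_derivative uy (x, y)) (at y within {0..y0})) \<and>
      (\<forall>x\<in>{0<..<x0}. \<forall>y\<in>{0<..<y0}.
        ((\<lambda>t. ux (t, y)) has_real_derivative uxx (x, y)) (at x) \<and>
        ((\<lambda>t. uy (x, t)) has_real_derivative uyy (x, y)) (at y) \<and>
        - (uxx (x, y) + uyy (x, y)) = g) \<and>
      (\<forall>y\<in>{0<..y0}. u (0, y) = b) \<and>
      (\<forall>y\<in>{0<..y0}. - ux (x0, y) = q) \<and>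
      (\<forall>x\<in>{0..x0}. - (- uy (x, 0)) = 0 \<and> - uy (x, y0) = 0))"

text \<open>
  Solutions of \<open>(S)\<close> exist and are unique on the closed rectangle (lemma \<open>state_eq\<close> below), so
  the choice only affects irrelevant values outside of it.
\<close>
definition state ::
  "real \<Rightarrow> real \<Rightarrow> real \<Rightarrow> real \<Rightarrow> real \<Rightarrow> real \<times> real \<Rightarrow> real" where
  "state x0 y0 q b g = (SOME u. solves_S x0 y0 q b g u)"

text \<open>
  Here \<open>h = x0 / n\<close> and \<open>i\<close> is a cell index \<open>1 \<le> i \<le> n\<close> with \<open>(i - 1) h \<le> x \<le> i h\<close>. At a node
  shared by two cells both indices give the same value (lemma \<open>discrete_state_eq\<close> below).
\<close>
definition cell_index :: "real \<Rightarrow> nat \<Rightarrow> real \<Rightarrow> nat" where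
  "cell_index h n x = (LEAST i. i \<in> {1..n} \<and> x \<in> {(real i - 1) * h .. real i * h})"

definition discrete_state ::
  "real \<Rightarrow> real \<Rightarrow> real \<Rightarrow> nat \<Rightarrow> real \<Rightarrow> real \<times> real \<Rightarrow> real" where
  "discrete_state x0 q b n g = (\<lambda>(x, y).
     let h = x0 / real n; i = real (cell_index h n x)
     in (g * x0 - q - h * g * i) * x + h\<^sup>2 * g * (i * (i - 1) / 2) + b)"

definition J1 ::
  "real \<Rightarrow> real \<Rightarrow> real \<Rightarrow> real \<Rightarrow> real \<Rightarrow> real \<Rightarrow> real \<Rightarrow> real" where
  "J1 x0 y0 q b zd M1 g =
     1/2 * (H_norm x0 y0 (\<lambda>p. state x0 y0 q b g p - zd))\<^sup>2
     + M1 / 2 * (H_norm x0 y0 (\<lambda>p. g))\<^sup>2"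

definition J1_discrete ::
  "real \<Rightarrow> real \<Rightarrow> real \<Rightarrow> real \<Rightarrow> real \<Rightarrow> real \<Rightarrow> nat \<Rightarrow> real \<Rightarrow> real" where
  "J1_discrete x0 y0 q b zd M1 n g =
     1/2 * (H_norm x0 y0 (\<lambda>p. discrete_state x0 q b n g p - zd))\<^sup>2
     + M1 / 2 * (H_norm x0 y0 (\<lambda>p. g))\<^sup>2"

definition g_op :: "real \<Rightarrow> real \<Rightarrow> real \<Rightarrow> real \<Rightarrow> real \<Rightarrow> real \<Rightarrow> real" where
  "g_op x0 y0 q b zd M1 = (ARG_MIN (J1 x0 y0 q b zd M1) g. True)"

definition g_op_discrete ::
  "real \<Rightarrow> real \<Rightarrow> real \<Rightarrow> real \<Rightarrow> real \<Rightarrow> real \<Rightarrow> nat \<Rightarrow> real" where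
  "g_op_discrete x0 y0 q b zd M1 n = (ARG_MIN (J1_discrete x0 y0 q b zd M1 n) g. True)"

lemma discrete_state_eq:
  assumes "x0 > 0" and i: "i \<in> {1..n}"
    and h: "h = x0 / real n"
    and x: "x \<in> {(real i - 1) * h .. real i * h}"
  shows "discrete_state x0 q b n g (x, y) =
    (g * x0 - q - h * g * real i) * x + h\<^sup>2 * g * (real i * (real i - 1) / 2) + b"
proof -
  define j where "j = cell_index h n x"
  have hpos: "h > 0" using assms by simp
  have j: "j \<in> {1..n} \<and> x \<in> {(real j - 1) * h .. real j * h}"
    unfolding j_def cell_index_def by (rule LeastI[of _ i]) (use i x in auto)
  have "j \<le> i"
    unfolding j_def cell_index_def by (rule Least_le) (use i x in auto)
  have eq: "(g * x0 - q - h * g * real j) * x + h\<^sup>2 * g * (real j * (real j - 1) / 2) + b =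
    (g * x0 - q - h * g * real i) * x + h\<^sup>2 * g * (real i * (real i - 1) / 2) + b"
  proof (cases "j = i")
    case False
    with \<open>j \<le> i\<close> have "real j \<le> real i - 1" by linarith
    moreover have "(real i - 1) * h \<le> real j * h" using j x by auto
    hence "real i - 1 \<le> real j" using hpos by simp
    ultimately have ri: "real i = real j + 1" by simp
    hence "x = real j * h" using j x by auto
    thus ?thesis unfolding ri by (simp add: field_simps power2_eq_square)
  qed simp
  show ?thesis
    unfolding discrete_state_def Let_def prod.case h[symmetric] j_def[symmetric] by (rule eq)
qed

lemma solves_S_explicit:
  assumes "x0 > 0" "y0 > 0"
  shows "solves_S x0 y0 q b g (\<lambda>(x, y). - (1/2) * g * x\<^sup>2 + (g * x0 - q) * x + b)"
  unfolding solves_S_def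
  by (rule exI[of _ "\<lambda>p. - g * fst p + (g * x0 - q)"], rule exI[of _ "\<lambda>_. 0"],
      rule exI[of _ "\<lambda>_. - g"], rule exI[of _ "\<lambda>_. 0"], intro conjI ballI)
     (auto simp: case_prod_unfold intro!: continuous_intros derivative_eq_intros)

lemma solves_S_E:
  assumes "solves_S x0 y0 q b g u"
  obtains ux uy uxx uyy where
    "continuous_on ({0..x0} \<times> {0..y0}) u"
    "continuous_on ({0..x0} \<times> {0..y0}) ux"
    "continuous_on ({0..x0} \<times> {0..y0}) uy"
    "\<And>x y. x\<in>{0..x0} \<Longrightarrow> y\<in>{0..y0} \<Longrightarrow> ((\<lambda>t. u (t, y)) has_real_derivative ux (x, y)) (at x within {0..x0})"
    "\<And>x y. x\<in>{0..x0} \<Longrightarrow> y\<in>{0..y0} \<Longrightarrow> ((\<lambda>t. u (x, t)) has_real_derivative uy (x, y)) (at y within {0..y0})"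
    "\<And>x y. x\<in>{0<..<x0} \<Longrightarrow> y\<in>{0<..<y0} \<Longrightarrow> ((\<lambda>t. ux (t, y)) has_real_derivative uxx (x, y)) (at x)"
    "\<And>x y. x\<in>{0<..<x0} \<Longrightarrow> y\<in>{0<..<y0} \<Longrightarrow> ((\<lambda>t. uy (x, t)) has_real_derivative uyy (x, y)) (at y)"
    "\<And>x y. x\<in>{0<..<x0} \<Longrightarrow> y\<in>{0<..<y0} \<Longrightarrow> - (uxx (x, y) + uyy (x, y)) = g"
    "\<And>y. y\<in>{0<..y0} \<Longrightarrow> u (0, y) = b"
    "\<And>y. y\<in>{0<..y0} \<Longrightarrow> - ux (x0, y) = q"
    "\<And>x. x\<in>{0..x0} \<Longrightarrow> uy (x, 0) = 0" "\<And>x. x\<in>{0..x0} \<Longrightarrow> uy (x, y0) = 0"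
  using assms unfolding solves_S_def
  apply (elim exE conjE)
  subgoal premises prems for ux uy uxx uyy
  proof (rule prems(1)[of ux uy uxx uyy])
    show "uy (x, 0) = 0" "uy (x, y0) = 0" if "x \<in> {0..x0}" for x
      using bspec[OF prems(9) that] by simp_all
  qed (use prems(2-8) in blast)+
  done

lemma solves_S_diff:
  assumes "solves_S x0 y0 q b g u" "solves_S x0 y0 q b g v"
  shows "solves_S x0 y0 0 0 0 (\<lambda>p. u p - v p)"
proof -
  obtain ux uy uxx uyy where u:
    "continuous_on ({0..x0} \<times> {0..y0}) u"
    "continuous_on ({0..x0} \<times> {0..y0}) ux"
    "continuous_on ({0..x0} \<times> {0..y0}) uy"
    "\<And>x y. x\<in>{0..x0} \<Longrightarrow> y\<in>{0..y0} \<Longrightarrow> ((\<lambda>t. u (t, y)) has_real_derivative ux (x, y)) (at x within {0..x0})"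
    "\<And>x y. x\<in>{0..x0} \<Longrightarrow> y\<in>{0..y0} \<Longrightarrow> ((\<lambda>t. u (x, t)) has_real_derivative uy (x, y)) (at y within {0..y0})"
    "\<And>x y. x\<in>{0<..<x0} \<Longrightarrow> y\<in>{0<..<y0} \<Longrightarrow> ((\<lambda>t. ux (t, y)) has_real_derivative uxx (x, y)) (at x)"
    "\<And>x y. x\<in>{0<..<x0} \<Longrightarrow> y\<in>{0<..<y0} \<Longrightarrow> ((\<lambda>t. uy (x, t)) has_real_derivative uyy (x, y)) (at y)"
    "\<And>x y. x\<in>{0<..<x0} \<Longrightarrow> y\<in>{0<..<y0} \<Longrightarrow> - (uxx (x, y) + uyy (x, y)) = g"
    "\<And>y. y\<in>{0<..y0} \<Longrightarrow> u (0, y) = b"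
    "\<And>y. y\<in>{0<..y0} \<Longrightarrow> - ux (x0, y) = q"
    "\<And>x. x\<in>{0..x0} \<Longrightarrow> uy (x, 0) = 0" "\<And>x. x\<in>{0..x0} \<Longrightarrow> uy (x, y0) = 0"
    by (fact solves_S_E[OF assms(1)])
  obtain vx vy vxx vyy where v:
    "continuous_on ({0..x0} \<times> {0..y0}) v"
    "continuous_on ({0..x0} \<times> {0..y0}) vx"
    "continuous_on ({0..x0} \<times> {0..y0}) vy"
    "\<And>x y. x\<in>{0..x0} \<Longrightarrow> y\<in>{0..y0} \<Longrightarrow> ((\<lambda>t. v (t, y)) has_real_derivative vx (x, y)) (at x within {0..x0})"
    "\<And>x y. x\<in>{0..x0} \<Longrightarrow> y\<in>{0..y0} \<Longrightarrow> ((\<lambda>t. v (x, t)) has_real_derivative vy (x, y)) (at y within {0..y0})"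
    "\<And>x y. x\<in>{0<..<x0} \<Longrightarrow> y\<in>{0<..<y0} \<Longrightarrow> ((\<lambda>t. vx (t, y)) has_real_derivative vxx (x, y)) (at x)"
    "\<And>x y. x\<in>{0<..<x0} \<Longrightarrow> y\<in>{0<..<y0} \<Longrightarrow> ((\<lambda>t. vy (x, t)) has_real_derivative vyy (x, y)) (at y)"
    "\<And>x y. x\<in>{0<..<x0} \<Longrightarrow> y\<in>{0<..<y0} \<Longrightarrow> - (vxx (x, y) + vyy (x, y)) = g"
    "\<And>y. y\<in>{0<..y0} \<Longrightarrow> v (0, y) = b"
    "\<And>y. y\<in>{0<..y0} \<Longrightarrow> - vx (x0, y) = q"
    "\<And>x. x\<in>{0..x0} \<Longrightarrow> vy (x, 0) = 0" "\<And>x. x\<in>{0..x0} \<Longrightarrow> vy (x, y0) = 0"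
    by (fact solves_S_E[OF assms(2)])
  show ?thesis
    unfolding solves_S_def
  proof (rule exI[of _ "\<lambda>p. ux p - vx p"], rule exI[of _ "\<lambda>p. uy p - vy p"],
      rule exI[of _ "\<lambda>p. uxx p - vxx p"], rule exI[of _ "\<lambda>p. uyy p - vyy p"],
      intro conjI ballI)
    show "- (uxx (x, y) - vxx (x, y) + (uyy (x, y) - vyy (x, y))) = 0"
      if "x\<in>{0<..<x0}" "y\<in>{0<..<y0}" for x y
      using u(8)[OF that] v(8)[OF that] by linarith
    show "- (ux (x0, y) - vx (x0, y)) = 0" if "y \<in> {0<..y0}" for y
      using u(10)[OF that] v(10)[OF that] by linarith
  qed (use u(1-7,9,11,12) v(1-7,9,11,12) in \<open>auto intro!: continuous_on_diff DERIV_diff\<close>)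
qed

lemma second_derivative_at_max:
  fixes f f' :: "real \<Rightarrow> real"
  assumes a: "a \<in> {0<..<X}"
    and f: "\<And>t. t \<in> {0<..<X} \<Longrightarrow> (f has_real_derivative f' t) (at t)"
    and f': "(f' has_real_derivative s) (at a)"
    and max: "\<And>t. t \<in> {0<..<X} \<Longrightarrow> f t \<le> f a"
  shows "s \<le> 0"
proof (rule ccontr)
  assume "\<not> s \<le> 0"
  have z: "f' a = 0"
  proof (rule DERIV_local_max[OF f[OF a], of "min a (X - a)"])
    show "0 < min a (X - a)" using a by auto
    show "\<forall>y. \<bar>a - y\<bar> < min a (X - a) \<longrightarrow> f y \<le> f a"
      using a by (intro allI impI max) auto
  qed
  obtain d where d: "d > 0" "\<And>k. 0 < k \<Longrightarrow> k < d \<Longrightarrow> f' a < f' (a + k)"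
    using has_real_derivative_pos_inc_right[OF f'] \<open>\<not> s \<le> 0\<close> by auto
  define k where "k = min d (X - a) / 2"
  have k: "0 < k" "k < d" "a + k < X" using d(1) a by (auto simp: k_def min_def field_simps)
  have "f a < f (a + k)"
  proof (rule DERIV_pos_imp_increasing_open[of a "a + k" f])
    show "a < a + k" using k by simp
    show "\<exists>y. (f has_real_derivative y) (at t) \<and> 0 < y" if "a < t" "t < a + k" for t
      using f[of t] d(2)[of "t - a"] that a k z by (intro exI[of _ "f' t"]) auto
    show "continuous_on {a..a + k} f"
      using a k by (intro DERIV_continuous_on[of _ _ f'] has_field_derivative_at_within[OF f]) auto
  qed
  with max[of "a + k"] a k show False by auto
qed

lemma solves_S_homogeneous_le_0:
  assumes pos: "x0 > 0" "y0 > 0" and S: "solves_S x0 y0 0 0 0 w"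
    and p: "p \<in> {0..x0} \<times> {0..y0}"
  shows "w p \<le> 0"
proof -
  let ?R = "{0..x0} \<times> {0..y0}"
  obtain ux uy uxx uyy where w:
    "continuous_on ?R w"
    "continuous_on ?R ux" "continuous_on ?R uy"
    "\<And>x y. x\<in>{0..x0} \<Longrightarrow> y\<in>{0..y0} \<Longrightarrow> ((\<lambda>t. w (t, y)) has_real_derivative ux (x, y)) (at x within {0..x0})"
    "\<And>x y. x\<in>{0..x0} \<Longrightarrow> y\<in>{0..y0} \<Longrightarrow> ((\<lambda>t. w (x, t)) has_real_derivative uy (x, y)) (at y within {0..y0})"
    "\<And>x y. x\<in>{0<..<x0} \<Longrightarrow> y\<in>{0<..<y0} \<Longrightarrow> ((\<lambda>t. ux (t, y)) has_real_derivative uxx (x, y)) (at x)"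
    "\<And>x y. x\<in>{0<..<x0} \<Longrightarrow> y\<in>{0<..<y0} \<Longrightarrow> ((\<lambda>t. uy (x, t)) has_real_derivative uyy (x, y)) (at y)"
    "\<And>x y. x\<in>{0<..<x0} \<Longrightarrow> y\<in>{0<..<y0} \<Longrightarrow> - (uxx (x, y) + uyy (x, y)) = 0"
    "\<And>y. y\<in>{0<..y0} \<Longrightarrow> w (0, y) = 0"
    "\<And>y. y\<in>{0<..y0} \<Longrightarrow> - ux (x0, y) = 0"
    "\<And>x. x\<in>{0..x0} \<Longrightarrow> uy (x, 0) = 0" "\<And>x. x\<in>{0..x0} \<Longrightarrow> uy (x, y0) = 0"
    by (fact solves_S_E[OF S])
  define \<psi> where "\<psi> = (\<lambda>(x, y). (4 * x0 + 1) * x - 2 * x\<^sup>2 + (y - y0 / 2)\<^sup>2)"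
  have le: "w p \<le> e * \<psi> p" if e: "e > 0" for e
  proof -
    define z where "z = (\<lambda>p. w p - e * \<psi> p)"
    have "continuous_on ?R z"
      unfolding z_def \<psi>_def case_prod_unfold by (intro continuous_intros w(1))
    moreover have "compact ?R" "?R \<noteq> {}" using pos by (auto intro: compact_Times)
    ultimately obtain m where m: "m \<in> ?R" "\<And>t. t \<in> ?R \<Longrightarrow> z t \<le> z m"
      using continuous_attains_sup[of ?R z] by auto
    obtain a c where ac: "m = (a, c)" by force
    have a: "a \<in> {0..x0}" and c: "c \<in> {0..y0}" using m(1) ac by auto
    have zx: "((\<lambda>t. z (t, y)) has_real_derivative ux (x, y) - e * (4 * x0 + 1 - 4 * x)) (at x within {0..x0})"
      if "x\<in>{0..x0}" "y\<in>{0..y0}" for x y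
      unfolding z_def \<psi>_def prod.case
      by (rule derivative_eq_intros w(4)[OF that] refl | simp)+
    have zy: "((\<lambda>t. z (x, t)) has_real_derivative uy (x, y) - e * (2 * y - y0)) (at y within {0..y0})"
      if "x\<in>{0..x0}" "y\<in>{0..y0}" for x y
      unfolding z_def \<psi>_def prod.case
      by (rule derivative_eq_intros w(5)[OF that] refl | simp)+
    consider "a = 0" | "c = 0" | "c = y0" | "a = x0" "0 < c"
      | "a \<in> {0<..<x0}" "c \<in> {0<..<y0}"
      using a c by fastforce
    hence "z m \<le> 0"
    proof cases
      case 1
      have "w (0, c) = 0"
      proof (cases "c = 0")
        case True
        have "continuous_on {0..y0} (\<lambda>t. w (0, t))"
          using DERIV_continuous_on[OF w(5)[of 0]] pos by auto
        hence "((\<lambda>t. w (0, t)) \<longlongrightarrow> w (0, 0)) (at 0 within {0..y0})"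
          using pos by (auto simp: continuous_on)
        hence "((\<lambda>t. w (0, t)) \<longlongrightarrow> w (0, 0)) (at_right 0)"
          using at_within_Icc_at_right[OF pos(2)] by simp
        moreover have "eventually (\<lambda>t. w (0, t) = 0) (at_right 0)"
          using eventually_at_right[OF pos(2)] w(9) pos by force
        hence "((\<lambda>t. w (0, t)) \<longlongrightarrow> 0) (at_right 0)"
          by (rule tendsto_eventually)
        ultimately show ?thesis
          using True tendsto_unique[of "at_right (0::real)"] by auto
      qed (use w(9) c in auto)
      thus ?thesis using e by (simp add: z_def \<psi>_def ac 1)
    next
      case 2
      have "0 < uy (a, c) - e * (2 * c - y0)" using w(11)[OF a] 2 pos e by simp
      then obtain d where d: "d > 0"
        "\<And>k. 0 < k \<Longrightarrow> c + k \<in> {0..y0} \<Longrightarrow> k < d \<Longrightarrow> z (a, c) < z (a, c + k)"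
        using has_real_derivative_pos_inc_right[OF zy[OF a c]] by blast
      have "z (a, c) < z (a, c + min d y0 / 2)" using d(1) 2 pos by (intro d(2)) auto
      moreover have "(a, c + min d y0 / 2) \<in> ?R" using d(1) 2 pos a by auto
      ultimately show ?thesis using m(2) ac by fastforce
    next
      case 3
      have "uy (a, c) - e * (2 * c - y0) < 0" using w(12)[OF a] 3 pos e by simp
      then obtain d where d: "d > 0"
        "\<And>k. 0 < k \<Longrightarrow> c - k \<in> {0..y0} \<Longrightarrow> k < d \<Longrightarrow> z (a, c) < z (a, c - k)"
        using has_real_derivative_neg_dec_left[OF zy[OF a c]] by blast
      have "z (a, c) < z (a, c - min d y0 / 2)" using d(1) 3 pos by (intro d(2)) auto
      moreover have "(a, c - min d y0 / 2) \<in> ?R" using d(1) 3 pos a by auto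
      ultimately show ?thesis using m(2) ac by fastforce
    next
      case 4
      have "ux (a, c) - e * (4 * x0 + 1 - 4 * a) < 0" using w(10)[of c] 4 c pos e by simp
      then obtain d where d: "d > 0"
        "\<And>k. 0 < k \<Longrightarrow> a - k \<in> {0..x0} \<Longrightarrow> k < d \<Longrightarrow> z (a, c) < z (a - k, c)"
        using has_real_derivative_neg_dec_left[OF zx[OF a c]] by blast
      have "z (a, c) < z (a - min d x0 / 2, c)" using d(1) 4 pos by (intro d(2)) auto
      moreover have "(a - min d x0 / 2, c) \<in> ?R" using d(1) 4 pos c by auto
      ultimately show ?thesis using m(2) ac by fastforce
    next
      case 5
      have "uxx (a, c) + 4 * e \<le> 0"
      proof (rule second_derivative_at_max[OF 5(1)])
        show "((\<lambda>t. z (t, c)) has_real_derivative ux (t, c) - e * (4 * x0 + 1 - 4 * t)) (at t)"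
          if "t \<in> {0<..<x0}" for t
          using zx[of t c] that c at_within_interior[of t "{0..x0}"] by auto
        show "((\<lambda>t. ux (t, c) - e * (4 * x0 + 1 - 4 * t)) has_real_derivative uxx (a, c) + 4 * e) (at a)"
          by (rule derivative_eq_intros w(6)[OF 5] refl | simp)+
      qed (use m(2) ac 5 in auto)
      moreover have "uyy (a, c) - 2 * e \<le> 0"
      proof (rule second_derivative_at_max[OF 5(2)])
        show "((\<lambda>t. z (a, t)) has_real_derivative uy (a, t) - e * (2 * t - y0)) (at t)"
          if "t \<in> {0<..<y0}" for t
          using zy[of a t] that a at_within_interior[of t "{0..y0}"] by auto
        show "((\<lambda>t. uy (a, t) - e * (2 * t - y0)) has_real_derivative uyy (a, c) - 2 * e) (at c)"
          by (rule derivative_eq_intros w(7)[OF 5] refl | simp)+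
      qed (use m(2) ac 5 in auto)
      ultimately show ?thesis using w(8)[OF 5] e by linarith
    qed
    with m(2)[OF p] show ?thesis by (simp add: z_def)
  qed
  show ?thesis
  proof (rule tendsto_lowerbound)
    show "((\<lambda>e. e * \<psi> p) \<longlongrightarrow> 0) (at_right 0)"
      by (auto intro!: tendsto_eq_intros)
    show "eventually (\<lambda>e. w p \<le> e * \<psi> p) (at_right 0)"
      using le by (auto simp: eventually_at_right_less eventually_at_filter)
  qed simp
qed

lemma solves_S_unique:
  assumes "x0 > 0" "y0 > 0" "solves_S x0 y0 q b g u" "solves_S x0 y0 q b g v"
    and "p \<in> {0..x0} \<times> {0..y0}"
  shows "u p = v p"
  using solves_S_homogeneous_le_0[OF assms(1,2) solves_S_diff[OF assms(3,4)] assms(5)]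
    solves_S_homogeneous_le_0[OF assms(1,2) solves_S_diff[OF assms(4,3)] assms(5)]
  by simp

lemma state_eq:
  assumes "x0 > 0" "y0 > 0" "x \<in> {0..x0}" "y \<in> {0..y0}"
  shows "state x0 y0 q b g (x, y) = - (1/2) * g * x\<^sup>2 + (g * x0 - q) * x + b"
proof -
  have "solves_S x0 y0 q b g (state x0 y0 q b g)"
    unfolding state_def
    by (rule someI[of "solves_S x0 y0 q b g", OF solves_S_explicit[OF assms(1,2)]])
  from solves_S_unique[OF assms(1,2) this solves_S_explicit[OF assms(1,2)], of "(x, y)"] assms
  show ?thesis by simp
qed

end

theory Submission
  imports Defs
begin

text \<open>
  Every function in the statement depends on \<open>x\<close> only (almost everywhere), so \<open>H\<close>-norms are
  \<open>sqrt y0\<close> times \<open>L\<^sup>2\<close>-norms on \<open>(0, x0)\<close> (\<open>H_norm_x\<close>). Both states are affine in the control: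
  \<open>u\<^sub>g = g \<phi> - q x + b\<close> with \<open>\<phi> = x0 x - x\<^sup>2/2\<close>, and \<open>u\<^sup>h\<^sub>g = g \<phi>\<^sup>h - q x + b\<close> with a
  continuous, piecewise linear \<open>\<phi>\<^sup>h\<close>. Everything rests on the expansion
  \<open>\<phi>\<^sup>h = \<phi> - h x/2 + O(h\<^sup>2)\<close>, uniform in \<open>x\<close> (\<open>discrete_profile_error\<close>): the function
  \<open>\<phi>\<^sup>h + h x/2\<close> is the linear interpolant of \<open>\<phi>\<close> on the grid.

  With \<open>p = q x - (b - zd)\<close> the costs are quadratic polynomials in \<open>g\<close>, minimised at
  \<open>\<integral>\<psi>p / (\<integral>\<psi>\<^sup>2 + M1 x0)\<close> for \<open>\<psi> = \<phi>\<close> and \<open>\<psi> = \<phi>\<^sup>h\<close>. Hence the optimal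
  controls satisfy \<open>g\<^sup>h = g + \<kappa> h + o(h)\<close> for a number \<open>\<kappa>\<close> (\<open>g_op_discrete_rate\<close>). Then:

  \<^item> \<open>(u\<^sub>g - u\<^sup>h) / h\<close> converges boundedly to \<open>g x/2 - \<kappa> \<phi>\<close>, so its norm converges
    (\<open>H_norm_state_error_tendsto\<close>).

  \<^item> On the \<open>i\<close>-th cell the derivatives differ by \<open>g (i h - x) - (g\<^sup>h - g) (x0 - i h)\<close>. Divided by
    \<open>h\<close>, the first term is a sawtooth with values in \<open>[0, 1]\<close>, which has no pointwise limit, but the
    integral of the square is an explicit sum over the cells and converges
    (\<open>H_norm_gradient_error_tendsto\<close>).

  Both limits are positive definite quadratic forms in \<open>(g, \<kappa>)\<close>, so positivity of the constants means
  \<open>(g, \<kappa>) \<noteq> (0, 0)\<close>. If \<open>g = 0\<close>, then \<open>5 q x0 = 8 (b - zd)\<close>; if moreover \<open>\<kappa> = 0\<close>, then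
  \<open>2 q x0 = 3 (b - zd)\<close>; together these force \<open>q = 0\<close>.
\<close>

section \<open>Integrals over bounded intervals\<close>

lemma set_integrable_bounded_Ioo:
  fixes f :: "real \<Rightarrow> real"
  assumes [measurable]: "f \<in> borel_measurable borel"
    and bound: "\<And>x. x \<in> {a<..<b} \<Longrightarrow> \<bar>f x\<bar> \<le> B"
  shows "set_integrable lborel {a<..<b} f"
  unfolding set_integrable_def
proof (rule integrableI_bounded_set[where A = "{a<..<b}" and B = B])
  show "emeasure lborel {a<..<b} < \<infinity>"
    by (cases "a \<le> b") auto
qed (use bound in auto)

lemma set_integrable_bounded_mult_Ioo:
  fixes f g :: "real \<Rightarrow> real"
  assumes [measurable]: "f \<in> borel_measurable borel" "g \<in> borel_measurable borel"
    and f: "\<And>x. x \<in> {a<..<b} \<Longrightarrow> \<bar>f x\<bar> \<le> B" and g: "\<And>x. x \<in> {a<..<b} \<Longrightarrow> \<bar>g x\<bar> \<le> C"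
  shows "set_integrable lborel {a<..<b} (\<lambda>x. f x * g x)"
proof (rule set_integrable_bounded_Ioo)
  show "\<bar>f x * g x\<bar> \<le> B * C" if "x \<in> {a<..<b}" for x
    using f[OF that] g[OF that] unfolding abs_mult by (intro mult_mono) auto
qed measurable

lemma set_integral_Ioo_FTC:
  fixes f F :: "real \<Rightarrow> real"
  assumes "a \<le> b" and f: "continuous_on {a..b} f"
    and F: "\<And>x. (F has_real_derivative f x) (at x)"
  shows "(LINT x:{a<..<b}|lborel. f x) = F b - F a"
proof -
  have "(LBINT x=ereal a..ereal b. f x) = F b - F a"
    using assms
    by (intro interval_integral_FTC_finite)
       (auto simp: has_real_derivative_iff_has_vector_derivative[symmetric]
             intro: has_field_derivative_at_within)
  with \<open>a \<le> b\<close> show ?thesis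
    by (simp add: interval_integral_Ioo)
qed

lemma set_integral_Ioo_bounded_convergence:
  fixes f :: "nat \<Rightarrow> real \<Rightarrow> real"
  assumes [measurable]: "\<And>n. f n \<in> borel_measurable borel" "g \<in> borel_measurable borel"
    and bound: "\<And>n x. n > 0 \<Longrightarrow> x \<in> {a<..<b} \<Longrightarrow> \<bar>f n x\<bar> \<le> B"
    and lim: "\<And>x. x \<in> {a<..<b} \<Longrightarrow> (\<lambda>n. f n x) \<longlonglongrightarrow> g x"
  shows "(\<lambda>n. LINT x:{a<..<b}|lborel. f n x) \<longlonglongrightarrow> (LINT x:{a<..<b}|lborel. g x)"
proof (rule LIMSEQ_imp_Suc)
  show "(\<lambda>n. LINT x:{a<..<b}|lborel. f (Suc n) x) \<longlonglongrightarrow> (LINT x:{a<..<b}|lborel. g x)"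
    unfolding set_lebesgue_integral_def
  proof (rule integral_dominated_convergence[where w = "\<lambda>x. indicator {a<..<b} x *\<^sub>R B"])
    show "integrable lborel (\<lambda>x. indicator {a<..<b} x *\<^sub>R B)"
      using set_integrable_bounded_Ioo[of "\<lambda>_. B" a b "\<bar>B\<bar>"] by (simp add: set_integrable_def)
    show "AE x in lborel. (\<lambda>n. indicator {a<..<b} x *\<^sub>R f (Suc n) x) \<longlonglongrightarrow> indicator {a<..<b} x *\<^sub>R g x"
      using lim by (intro AE_I2) (auto simp: indicator_def intro: LIMSEQ_Suc)
    show "AE x in lborel. norm (indicator {a<..<b} x *\<^sub>R f (Suc n) x) \<le> indicator {a<..<b} x *\<^sub>R B" for n
      using bound by (intro AE_I2) (auto simp: indicator_def)
  qed measurable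
qed

lemma set_integral_Ioo_cells:
  fixes f :: "real \<Rightarrow> real"
  assumes "h \<ge> 0" and "set_integrable lborel {0<..<real n * h} f"
  shows "(LINT x:{0<..<real n * h}|lborel. f x)
    = (\<Sum>i<n. LINT x:{real i * h<..<real (Suc i) * h}|lborel. f x)"
  using assms(2)
proof (induction n)
  case (Suc n)
  have le: "0 \<le> real n * h" "real n * h \<le> real (Suc n) * h"
    using assms(1) by (auto simp: algebra_simps)
  have "set_integrable lborel {0<..<real n * h} f"
    by (rule set_integrable_subset[OF Suc.prems]) (use le in auto)
  note IH = Suc.IH[OF this]
  have "(LBINT x=ereal 0..ereal (real n * h). f x) + (LBINT x=ereal (real n * h)..ereal (real (Suc n) * h). f x)
      = (LBINT x=ereal 0..ereal (real (Suc n) * h). f x)"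
    using le Suc.prems
    by (intro interval_integral_sum)
       (simp add: interval_lebesgue_integrable_def min_absorb1 max_absorb2 del: of_nat_Suc)
  moreover have "(LBINT x=ereal a..ereal b. f x) = (LINT x:{a<..<b}|lborel. f x)" if "a \<le> b" for a b
    using that by (simp add: interval_integral_Ioo)
  ultimately show ?case
    using le IH unfolding sum.lessThan_Suc by (simp del: of_nat_Suc)
qed (simp add: set_lebesgue_integral_def)

section \<open>Reduction of the norm to one variable\<close>

text \<open>
  Tonelli's theorem; working with nonnegative integrals covers the case that \<open>f\<^sup>2\<close> is not
  integrable, where both sides are \<open>0\<close>. The exceptional set \<open>N\<close> is there for the grid points, where the partial derivative
  of a piecewise linear function has an unspecified value: \<open>e\<close> carries that value. It may depend on
  \<open>x\<close> alone, because otherwise \<open>F\<close> could fail to be Borel on the vertical lines over \<open>N\<close>.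
\<close>

lemma H_norm_x:
  fixes f e :: "real \<Rightarrow> real"
  assumes pos: "x0 > 0" "y0 > 0" and [measurable]: "f \<in> borel_measurable borel"
    and N: "finite N"
    and F: "\<And>x y. x \<in> {0<..<x0} \<Longrightarrow> y \<in> {0<..<y0} \<Longrightarrow> F (x, y) = e x"
    and e: "\<And>x. x \<in> {0<..<x0} \<Longrightarrow> x \<notin> N \<Longrightarrow> e x = f x"
  shows "H_norm x0 y0 F = sqrt (y0 * (LINT x:{0<..<x0}|lborel. (f x)\<^sup>2))"
proof -
  define k where "k = (\<lambda>x. indicator {0<..<x0} x * (e x)\<^sup>2)"
  define l where "l = (\<lambda>x. indicator {0<..<x0} x * (f x)\<^sup>2)"
  have l [measurable]: "l \<in> borel_measurable borel"
    unfolding l_def by measurable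
  have kl: "k x = l x" if "x \<notin> N" for x
    using e that by (auto simp: k_def l_def indicator_def)
  have k [measurable]: "k \<in> borel_measurable borel"
    by (rule measurable_discrete_difference[OF l countable_finite[OF N]]) (auto simp: kl)
  have k0: "k x \<ge> 0" for x by (simp add: k_def)
  have "(LINT p:Omega x0 y0|lborel. (F p)\<^sup>2) = (LINT p|lborel. k (fst p) * indicator {0<..<y0} (snd p))"
    unfolding set_lebesgue_integral_def Omega_def
    by (intro Bochner_Integration.integral_cong) (auto simp: k_def F indicator_def)
  also have "\<dots> = enn2real (\<integral>\<^sup>+p. ennreal (k (fst p) * indicator {0<..<y0} (snd p)) \<partial>lborel)"
    by (rule integral_eq_nn_integral) (auto simp: k0 lborel_prod[symmetric] simp del: lborel_prod)
  also have "(\<integral>\<^sup>+p. ennreal (k (fst p) * indicator {0<..<y0} (snd p)) \<partial>lborel)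
      = (\<integral>\<^sup>+x. \<integral>\<^sup>+y. ennreal (k x) * indicator {0<..<y0} y \<partial>lborel \<partial>lborel)"
    unfolding lborel_prod[symmetric]
    by (subst lborel.nn_integral_fst[symmetric]) (auto simp: k0 ennreal_mult ennreal_indicator)
  also have "\<dots> = (\<integral>\<^sup>+x. ennreal (k x) * ennreal y0 \<partial>lborel)"
    using pos by (simp add: nn_integral_cmult)
  also have "\<dots> = (\<integral>\<^sup>+x. ennreal (k x) \<partial>lborel) * ennreal y0"
    by (simp add: nn_integral_multc)
  also have "enn2real \<dots> = enn2real (\<integral>\<^sup>+x. ennreal (k x) \<partial>lborel) * y0"
    using pos by (simp add: enn2real_mult)
  also have "enn2real (\<integral>\<^sup>+x. ennreal (k x) \<partial>lborel) = (LINT x|lborel. k x)"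
    by (rule integral_eq_nn_integral[symmetric]) (auto simp: k0)
  also have "\<dots> = (LINT x|lborel. l x)"
    by (rule integral_discrete_difference[OF countable_finite[OF N]]) (auto simp: kl)
  finally show ?thesis
    by (simp add: H_norm_def l_def set_lebesgue_integral_def mult.commute)
qed

lemmas H_norm_x' = H_norm_x[where N = "{}", OF _ _ _ finite.emptyI]

section \<open>Minimisers of the cost functions\<close>

lemma arg_min_quadratic:
  fixes D N c :: real
  assumes "D > 0" and "c > 0"
  shows "(ARG_MIN (\<lambda>g. c * (g\<^sup>2 * D - 2 * g * N + k)) g. True) = N / D"
proof -
  let ?f = "\<lambda>g. c * (g\<^sup>2 * D - 2 * g * N + k)"
  have eq: "?f g = ?f (N / D) + c * D * (g - N / D)\<^sup>2" for g
    using assms by (simp add: field_simps power2_eq_square)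
  show ?thesis
  proof (rule arg_minI)
    show "\<not> ?f g < ?f (N / D)" for g
      using assms eq[of g] by (simp add: not_less del: power2_diff)
    fix x assume "\<forall>y. True \<longrightarrow> \<not> ?f y < ?f x"
    then have "\<not> ?f (N / D) < ?f x" by blast
    then have "c * D * (x - N / D)\<^sup>2 \<le> 0" using eq[of x] by linarith
    with assms show "x = N / D" by (simp add: mult_le_0_iff)
  qed simp
qed

text \<open>
  The common shape of the continuous and the discrete problem: the deviation from the target is affine
  in the control, so the cost is \<open>y0/2\<close> times a quadratic polynomial in \<open>g\<close> with leading coefficient
  \<open>\<integral>\<psi>\<^sup>2 + M1 x0\<close>.
\<close>

lemma arg_min_tracking_cost:
  fixes \<psi> p :: "real \<Rightarrow> real"
  assumes pos: "x0 > 0" "y0 > 0" "M1 > 0"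
    and [measurable]: "\<psi> \<in> borel_measurable borel" "p \<in> borel_measurable borel"
    and \<psi>: "\<And>x. x \<in> {0<..<x0} \<Longrightarrow> \<bar>\<psi> x\<bar> \<le> B"
    and p: "\<And>x. x \<in> {0<..<x0} \<Longrightarrow> \<bar>p x\<bar> \<le> C"
    and U: "\<And>g x y. x \<in> {0<..<x0} \<Longrightarrow> y \<in> {0<..<y0} \<Longrightarrow> U g (x, y) = g * \<psi> x - p x"
  shows "(ARG_MIN (\<lambda>g. 1/2 * (H_norm x0 y0 (U g))\<^sup>2 + M1/2 * (H_norm x0 y0 (\<lambda>_. g))\<^sup>2) g. True)
    = (LINT x:{0<..<x0}|lborel. \<psi> x * p x) / ((LINT x:{0<..<x0}|lborel. (\<psi> x)\<^sup>2) + M1 * x0)"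
proof -
  let ?I = "\<lambda>f::real\<Rightarrow>real. LINT x:{0<..<x0}|lborel. f x"
  have int: "set_integrable lborel {0<..<x0} (\<lambda>x. (\<psi> x)\<^sup>2)"
      "set_integrable lborel {0<..<x0} (\<lambda>x. \<psi> x * p x)"
      "set_integrable lborel {0<..<x0} (\<lambda>x. (p x)\<^sup>2)"
    unfolding power2_eq_square
    by (rule set_integrable_bounded_mult_Ioo assms | assumption)+
  have nn: "?I (\<lambda>x. (f x)\<^sup>2) \<ge> 0" for f :: "real \<Rightarrow> real"
    unfolding set_lebesgue_integral_def by (intro Bochner_Integration.integral_nonneg) auto
  have 1: "(H_norm x0 y0 (U g))\<^sup>2 = y0 * (g\<^sup>2 * ?I (\<lambda>x. (\<psi> x)\<^sup>2) - 2 * g * ?I (\<lambda>x. \<psi> x * p x) + ?I (\<lambda>x. (p x)\<^sup>2))" for g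
  proof -
    have "(H_norm x0 y0 (U g))\<^sup>2 = y0 * ?I (\<lambda>x. (g * \<psi> x - p x)\<^sup>2)"
      using nn pos by (subst H_norm_x'[where f = "\<lambda>x. g * \<psi> x - p x"]) (auto simp: U)
    also have "(\<lambda>x. (g * \<psi> x - p x)\<^sup>2) = (\<lambda>x. g\<^sup>2 * (\<psi> x)\<^sup>2 - (2 * g) * (\<psi> x * p x) + (p x)\<^sup>2)"
      by (auto simp: algebra_simps power2_eq_square)
    finally show ?thesis
      using int by (simp add: set_integral_add set_integral_diff)
  qed
  have 2: "(H_norm x0 y0 (\<lambda>_. g))\<^sup>2 = y0 * (g\<^sup>2 * x0)" for g
    using pos nn[of "\<lambda>_. g"]
    by (subst H_norm_x'[where f = "\<lambda>x. g"]) (auto simp: set_integral_const mult.commute)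
  have "?I (\<lambda>x. (\<psi> x)\<^sup>2) + M1 * x0 > 0"
    using nn[of \<psi>] pos by (simp add: add_nonneg_pos)
  then have "(ARG_MIN (\<lambda>g. y0/2 * (g\<^sup>2 * (?I (\<lambda>x. (\<psi> x)\<^sup>2) + M1 * x0)
      - 2 * g * ?I (\<lambda>x. \<psi> x * p x) + ?I (\<lambda>x. (p x)\<^sup>2))) g. True)
    = ?I (\<lambda>x. \<psi> x * p x) / (?I (\<lambda>x. (\<psi> x)\<^sup>2) + M1 * x0)"
    using pos by (intro arg_min_quadratic) auto
  also have "(\<lambda>g. y0/2 * (g\<^sup>2 * (?I (\<lambda>x. (\<psi> x)\<^sup>2) + M1 * x0)
      - 2 * g * ?I (\<lambda>x. \<psi> x * p x) + ?I (\<lambda>x. (p x)\<^sup>2)))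
    = (\<lambda>g. 1/2 * (H_norm x0 y0 (U g))\<^sup>2 + M1/2 * (H_norm x0 y0 (\<lambda>_. g))\<^sup>2)"
    unfolding 1 2 by (auto simp: algebra_simps)
  finally show ?thesis .
qed

section \<open>Response to a unit source\<close>

text \<open>The coefficient of \<open>g\<close> in the solution of \<open>(S)\<close>.\<close>

definition profile :: "real \<Rightarrow> real \<Rightarrow> real" where
  "profile x0 x = x0 * x - x\<^sup>2 / 2"

text \<open>
  The coefficient of \<open>g\<close> in the discrete solution. The ceiling is the index of the cell that contains
  \<open>x\<close>, for all \<open>x\<close> in \<open>(0, x0]\<close>; unlike a least index it is evidently Borel measurable.
\<close>

definition discrete_profile :: "real \<Rightarrow> nat \<Rightarrow> real \<Rightarrow> real" where
  "discrete_profile x0 n x = (let h = x0 / real n; i = of_int \<lceil>x / h\<rceil>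
     in (x0 - h * i) * x + h\<^sup>2 * (i * (i - 1) / 2))"

lemma profile_measurable [measurable]: "profile x0 \<in> borel_measurable borel"
  unfolding profile_def by measurable

lemma discrete_profile_measurable [measurable]: "discrete_profile x0 n \<in> borel_measurable borel"
  unfolding discrete_profile_def Let_def by measurable

lemma cell_of_point:
  assumes "x0 > 0" "n > 0" "x \<in> {0<..<x0}"
  obtains i where "i \<in> {1..n}" "\<lceil>x / (x0 / real n)\<rceil> = int i"
    "(real i - 1) * (x0 / real n) < x" "x \<le> real i * (x0 / real n)"
proof -
  define h where "h = x0 / real n"
  have h: "h > 0" "real n * h = x0" using assms by (auto simp: h_def)
  have "0 < x / h" using h assms by simp
  then have c: "\<lceil>x / h\<rceil> \<ge> 1" by (simp add: one_le_ceiling)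
  have "x / h \<le> real n" using h assms by (simp add: field_simps)
  then have "\<lceil>x / h\<rceil> \<le> int n" by (simp add: ceiling_le_iff)
  moreover have "nat k \<in> {1..n} \<and> k = int (nat k)" if "k \<ge> 1" "k \<le> int n" for k
    using that by auto
  ultimately have "nat \<lceil>x / h\<rceil> \<in> {1..n}" "\<lceil>x / h\<rceil> = int (nat \<lceil>x / h\<rceil>)"
    using c by blast+
  moreover have "real (nat \<lceil>x / h\<rceil>) = of_int \<lceil>x / h\<rceil>" using c by simp
  moreover have "(of_int \<lceil>x / h\<rceil> - 1) * h < x" "x \<le> of_int \<lceil>x / h\<rceil> * h"
    using ceiling_correct[of "x / h"]
    unfolding pos_less_divide_eq[OF h(1)] pos_divide_le_eq[OF h(1)] by blast+
  ultimately show thesis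
    unfolding h_def by (intro that[of "nat \<lceil>x / (x0 / real n)\<rceil>"]) simp_all
qed

lemma discrete_state_profile:
  assumes "x0 > 0" "n > 0" "x \<in> {0<..<x0}"
  shows "discrete_state x0 q b n g (x, y) = g * discrete_profile x0 n x - q * x + b"
proof -
  obtain i where i: "i \<in> {1..n}" "\<lceil>x / (x0 / real n)\<rceil> = int i"
    "(real i - 1) * (x0 / real n) < x" "x \<le> real i * (x0 / real n)"
    using cell_of_point[OF assms] .
  show ?thesis
    using discrete_state_eq[OF assms(1) i(1) refl, of x q b g y] i
    by (simp add: discrete_profile_def Let_def algebra_simps)
qed

lemma state_profile:
  assumes "x0 > 0" "y0 > 0" "x \<in> {0..x0}" "y \<in> {0..y0}"
  shows "state x0 y0 q b g (x, y) = g * profile x0 x - q * x + b"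
  using state_eq[OF assms] by (simp add: profile_def algebra_simps)

text \<open>
  With \<open>t\<close> the distance from \<open>x\<close> to the right end of its cell, the error of linear interpolation of
  \<open>profile\<close> is \<open>t (h - t) / 2\<close>, at most \<open>h\<^sup>2/8\<close>.
\<close>

lemma discrete_profile_error:
  assumes "x0 > 0" "n > 0" "x \<in> {0<..<x0}"
  shows "\<bar>(discrete_profile x0 n x - profile x0 x) / (x0 / real n) + x / 2\<bar> \<le> x0 / real n / 8"
proof -
  define h where "h = x0 / real n"
  have h: "h > 0" using assms by (simp add: h_def)
  obtain i where i: "i \<in> {1..n}" "\<lceil>x / h\<rceil> = int i" "(real i - 1) * h < x" "x \<le> real i * h"
    using cell_of_point[OF assms] unfolding h_def .
  define t where "t = real i * h - x"
  have t: "0 \<le> t" "t < h" using i by (auto simp: t_def algebra_simps)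
  have x: "x = real i * h - t" by (simp add: t_def)
  have "(discrete_profile x0 n x - profile x0 x) / h + x / 2 = - (t * (h - t) / 2) / h"
    unfolding discrete_profile_def Let_def h_def[symmetric] i(2) profile_def
    using h by (simp add: x) (simp add: field_simps power2_eq_square)
  moreover have "0 \<le> t * (h - t) / 2" using t by simp
  moreover have "t * (h - t) / 2 \<le> h / 8 * h"
    using zero_le_power2[of "h - 2 * t"] by (simp add: algebra_simps power2_eq_square)
  ultimately show ?thesis
    using h unfolding h_def[symmetric] by (simp add: pos_divide_le_eq)
qed

lemma discrete_profile_tendsto:
  assumes "x0 > 0" "x \<in> {0<..<x0}"
  shows "(\<lambda>n. (discrete_profile x0 n x - profile x0 x) / (x0 / real n)) \<longlonglongrightarrow> - (x / 2)"
    and "(\<lambda>n. discrete_profile x0 n x) \<longlonglongrightarrow> profile x0 x"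
proof -
  have h: "(\<lambda>n. x0 / real n) \<longlonglongrightarrow> 0"
    by (intro tendsto_divide_0[OF tendsto_const] filterlim_at_top_imp_at_infinity filterlim_real_sequentially)
  have "(\<lambda>n. (discrete_profile x0 n x - profile x0 x) / (x0 / real n) + x / 2) \<longlonglongrightarrow> 0"
  proof (rule Lim_null_comparison)
    show "eventually (\<lambda>n. norm ((discrete_profile x0 n x - profile x0 x) / (x0 / real n) + x / 2) \<le> x0 / real n / 8) sequentially"
      using eventually_gt_at_top[of 0] by eventually_elim (use discrete_profile_error assms in auto)
    show "(\<lambda>n. x0 / real n / 8) \<longlonglongrightarrow> 0"
      using tendsto_divide[OF h tendsto_const[of 8]] by simp
  qed
  from tendsto_diff[OF this tendsto_const[of "x / 2"]]
  show 1: "(\<lambda>n. (discrete_profile x0 n x - profile x0 x) / (x0 / real n)) \<longlonglongrightarrow> - (x / 2)"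
    by simp
  have "(\<lambda>n. (discrete_profile x0 n x - profile x0 x) / (x0 / real n) * (x0 / real n) + profile x0 x)
      \<longlonglongrightarrow> - (x / 2) * 0 + profile x0 x"
    by (intro tendsto_intros 1 h)
  moreover have "eventually (\<lambda>n. (discrete_profile x0 n x - profile x0 x) / (x0 / real n) * (x0 / real n) + profile x0 x
      = discrete_profile x0 n x) sequentially"
    using eventually_gt_at_top[of 0] by eventually_elim (use assms in auto)
  ultimately show "(\<lambda>n. discrete_profile x0 n x) \<longlonglongrightarrow> profile x0 x"
    by (simp add: tendsto_cong)
qed

text \<open>
  The crude uniform bounds below provide the dominating constants for passing to the limit under
  the integral.
\<close>

lemma discrete_profile_rate_bound:
  assumes "x0 > 0" "n > 0" "x \<in> {0<..<x0}"
  shows "\<bar>(discrete_profile x0 n x - profile x0 x) / (x0 / real n)\<bar> \<le> x0"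
proof -
  have "x0 / real n / 8 \<le> x0 / 8" using assms by (simp add: divide_le_eq)
  with discrete_profile_error[OF assms]
  have "\<bar>(discrete_profile x0 n x - profile x0 x) / (x0 / real n) + x / 2\<bar> \<le> x0 / 8"
    by (rule order_trans)
  moreover have "\<bar>r\<bar> \<le> x0" if "\<bar>r + x / 2\<bar> \<le> x0 / 8" for r
    using that assms unfolding greaterThanLessThan_iff by linarith
  ultimately show ?thesis by blast
qed

lemma profile_bound:
  assumes "x \<in> {0<..<x0}"
  shows "\<bar>profile x0 x\<bar> \<le> x0\<^sup>2"
proof -
  have "0 \<le> x * (x0 - x / 2)" using assms by (intro mult_nonneg_nonneg) auto
  moreover have "x * (x0 - x / 2) \<le> x0 * x0" using assms by (intro mult_mono) auto
  ultimately show ?thesis by (simp add: profile_def algebra_simps power2_eq_square)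
qed

lemma discrete_profile_bound:
  assumes "x0 > 0" "n > 0" "x \<in> {0<..<x0}"
  shows "\<bar>discrete_profile x0 n x\<bar> \<le> 2 * x0\<^sup>2"
proof -
  have "\<bar>(discrete_profile x0 n x - profile x0 x) / (x0 / real n) * (x0 / real n)\<bar> \<le> x0 * x0"
    unfolding abs_mult
    using discrete_profile_rate_bound[OF assms] assms by (intro mult_mono) (auto simp: divide_le_eq)
  then have "\<bar>discrete_profile x0 n x - profile x0 x\<bar> \<le> x0\<^sup>2"
    using assms by (simp add: power2_eq_square)
  with profile_bound[OF assms(3)] show ?thesis by linarith
qed

lemma affine_bound:
  fixes x :: real
  assumes "x \<in> {0<..<x0}"
  shows "\<bar>q * x - c\<bar> \<le> \<bar>q\<bar> * x0 + \<bar>c\<bar>"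
proof -
  have "\<bar>q * x\<bar> \<le> \<bar>q\<bar> * x0" unfolding abs_mult using assms by (intro mult_left_mono) auto
  then show ?thesis by linarith
qed

section \<open>Explicit integrals\<close>

lemma integral_profile_quadratic:
  assumes "x0 > 0"
  shows "(LINT x:{0<..<x0}|lborel. (\<alpha> * x - \<beta> * profile x0 x)\<^sup>2)
    = \<alpha>\<^sup>2 * x0 ^ 3 / 3 - 5 / 12 * \<alpha> * \<beta> * x0 ^ 4 + 2 / 15 * \<beta>\<^sup>2 * x0 ^ 5"
proof -
  let ?c = "\<alpha> - \<beta> * x0"
  have "(LINT x:{0<..<x0}|lborel. (?c * x + \<beta> / 2 * x ^ 2)\<^sup>2)
     = (?c\<^sup>2 * x0 ^ 3 / 3 + ?c * \<beta> * x0 ^ 4 / 4 + \<beta>\<^sup>2 * x0 ^ 5 / 20)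
     - (?c\<^sup>2 * 0 ^ 3 / 3 + ?c * \<beta> * 0 ^ 4 / 4 + \<beta>\<^sup>2 * 0 ^ 5 / 20)"
    using assms
    by (intro set_integral_Ioo_FTC)
       (auto intro!: continuous_intros derivative_eq_intros
         simp: field_simps power2_eq_square power3_eq_cube power4_eq_xxxx)
  also have "(\<lambda>x. (?c * x + \<beta> / 2 * x ^ 2)\<^sup>2) = (\<lambda>x. (\<alpha> * x - \<beta> * profile x0 x)\<^sup>2)"
    by (auto simp: profile_def algebra_simps)
  finally show ?thesis
    by (simp add: field_simps eval_nat_numeral)
qed

lemma integral_profile_affine:
  assumes "x0 > 0"
  shows "(LINT x:{0<..<x0}|lborel. profile x0 x * (\<alpha> * x - \<beta>)) = 5 / 24 * \<alpha> * x0 ^ 4 - \<beta> * x0 ^ 3 / 3"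
proof -
  let ?F = "\<lambda>x. \<alpha> * (x0 * x ^ 3 / 3 - x ^ 4 / 8) - \<beta> * (x0 * x ^ 2 / 2 - x ^ 3 / 6)"
  have "(LINT x:{0<..<x0}|lborel. profile x0 x * (\<alpha> * x - \<beta>)) = ?F x0 - ?F 0"
    using assms
    by (intro set_integral_Ioo_FTC) (auto simp: profile_def intro!: continuous_intros derivative_eq_intros,
       simp_all add: field_simps power2_eq_square power3_eq_cube)
  then show ?thesis
    by (simp add: field_simps eval_nat_numeral)
qed

lemma integral_linear_affine:
  fixes x0 \<alpha> \<beta> :: real
  assumes "x0 > 0"
  shows "(LINT x:{0<..<x0}|lborel. - (x / 2) * (\<alpha> * x - \<beta>)) = \<beta> * x0\<^sup>2 / 4 - \<alpha> * x0 ^ 3 / 6"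
proof -
  let ?F = "\<lambda>x::real. \<beta> * x\<^sup>2 / 4 - \<alpha> * x ^ 3 / 6"
  have "(LINT x:{0<..<x0}|lborel. - (x / 2) * (\<alpha> * x - \<beta>)) = ?F x0 - ?F 0"
    using assms
    by (intro set_integral_Ioo_FTC) (auto intro!: continuous_intros derivative_eq_intros,
       simp_all add: field_simps power2_eq_square)
  then show ?thesis by simp
qed

section \<open>The optimal controls\<close>

lemma g_op_eq:
  assumes "x0 > 0" "y0 > 0" "M1 > 0"
  shows "g_op x0 y0 q b zd M1 =
    (LINT x:{0<..<x0}|lborel. profile x0 x * (q * x - (b - zd)))
    / ((LINT x:{0<..<x0}|lborel. (profile x0 x)\<^sup>2) + M1 * x0)"
proof -
  have "J1 x0 y0 q b zd M1 = (\<lambda>g. 1/2 * (H_norm x0 y0 (\<lambda>p. state x0 y0 q b g p - zd))\<^sup>2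
     + M1 / 2 * (H_norm x0 y0 (\<lambda>p. g))\<^sup>2)"
    by (auto simp: J1_def)
  then show ?thesis
    unfolding g_op_def
    using assms
    by (simp only:) (rule arg_min_tracking_cost[where B = "x0\<^sup>2" and C = "\<bar>q\<bar> * x0 + \<bar>b - zd\<bar>"];
      use profile_bound[of _ x0] affine_bound[of _ x0 q "b - zd"] in \<open>simp add: state_profile\<close>)
qed

lemma g_op_discrete_eq:
  assumes "x0 > 0" "y0 > 0" "M1 > 0" "n > 0"
  shows "g_op_discrete x0 y0 q b zd M1 n =
    (LINT x:{0<..<x0}|lborel. discrete_profile x0 n x * (q * x - (b - zd)))
    / ((LINT x:{0<..<x0}|lborel. (discrete_profile x0 n x)\<^sup>2) + M1 * x0)"
proof -
  have "J1_discrete x0 y0 q b zd M1 n = (\<lambda>g. 1/2 * (H_norm x0 y0 (\<lambda>p. discrete_state x0 q b n g p - zd))\<^sup>2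
     + M1 / 2 * (H_norm x0 y0 (\<lambda>p. g))\<^sup>2)"
    by (auto simp: J1_discrete_def)
  then show ?thesis
    unfolding g_op_discrete_def
    using assms
    by (simp only:) (rule arg_min_tracking_cost[where B = "2 * x0\<^sup>2" and C = "\<bar>q\<bar> * x0 + \<bar>b - zd\<bar>"];
      use discrete_profile_bound[of x0 n] affine_bound[of _ x0 q "b - zd"] in \<open>simp add: discrete_state_profile\<close>)
qed

text \<open>
  First variation of the numerator of the optimal control; the difference quotients of
  \<open>discrete_profile\<close> converge boundedly to \<open>- x/2\<close>.
\<close>

lemma discrete_profile_functional_rate:
  assumes x0: "x0 > 0" and [measurable]: "p \<in> borel_measurable borel"
    and p: "\<And>x. x \<in> {0<..<x0} \<Longrightarrow> \<bar>p x\<bar> \<le> C"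
  shows "(\<lambda>n. ((LINT x:{0<..<x0}|lborel. discrete_profile x0 n x * p x)
      - (LINT x:{0<..<x0}|lborel. profile x0 x * p x)) / (x0 / real n))
    \<longlonglongrightarrow> (LINT x:{0<..<x0}|lborel. - (x / 2) * p x)"
proof -
  define r where "r n x = (discrete_profile x0 n x - profile x0 x) / (x0 / real n)" for n x
  have "(\<lambda>n. LINT x:{0<..<x0}|lborel. r n x * p x) \<longlonglongrightarrow> (LINT x:{0<..<x0}|lborel. - (x / 2) * p x)"
  proof (rule set_integral_Ioo_bounded_convergence)
    show "\<bar>r n x * p x\<bar> \<le> x0 * C" if "n > 0" "x \<in> {0<..<x0}" for n x
      unfolding abs_mult r_def
      using discrete_profile_rate_bound[OF x0 that] p[OF that(2)] x0 by (intro mult_mono) auto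
    show "(\<lambda>n. r n x * p x) \<longlonglongrightarrow> - (x / 2) * p x" if "x \<in> {0<..<x0}" for x
      unfolding r_def by (intro tendsto_intros discrete_profile_tendsto[OF x0 that])
  qed (unfold r_def, measurable)
  moreover have "eventually (\<lambda>n. (LINT x:{0<..<x0}|lborel. r n x * p x)
      = ((LINT x:{0<..<x0}|lborel. discrete_profile x0 n x * p x)
      - (LINT x:{0<..<x0}|lborel. profile x0 x * p x)) / (x0 / real n)) sequentially"
    using eventually_gt_at_top[of 0]
  proof eventually_elim
    case (elim n)
    have i: "set_integrable lborel {0<..<x0} (\<lambda>x. discrete_profile x0 n x * p x)"
      "set_integrable lborel {0<..<x0} (\<lambda>x. profile x0 x * p x)"
      using discrete_profile_bound[OF x0 elim] profile_bound p
      by (intro set_integrable_bounded_mult_Ioo; auto)+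
    have "(\<lambda>x. r n x * p x) = (\<lambda>x. (discrete_profile x0 n x * p x - profile x0 x * p x) / (x0 / real n))"
      by (auto simp: r_def algebra_simps diff_divide_distrib)
    then show ?case
      by (simp only: set_integral_divide_zero set_integral_diff[OF i])
  qed
  ultimately show ?thesis
    by (rule Lim_transform_eventually)
qed

text \<open>
  First variation of the denominator: the difference of squares factors, one factor divided by \<open>h\<close> tends
  to \<open>- x/2\<close> and the other to \<open>2 profile\<close>.
\<close>

lemma discrete_profile_square_rate:
  assumes x0: "x0 > 0"
  shows "(\<lambda>n. ((LINT x:{0<..<x0}|lborel. (discrete_profile x0 n x)\<^sup>2)
      - (LINT x:{0<..<x0}|lborel. (profile x0 x)\<^sup>2)) / (x0 / real n))
    \<longlonglongrightarrow> (LINT x:{0<..<x0}|lborel. profile x0 x * (- x))"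
proof -
  define r where "r n x = (discrete_profile x0 n x - profile x0 x) / (x0 / real n)" for n x
  define s where "s n x = discrete_profile x0 n x + profile x0 x" for n x
  have [measurable]: "r n \<in> borel_measurable borel" "s n \<in> borel_measurable borel" for n
    unfolding r_def s_def by measurable
  have "(\<lambda>n. LINT x:{0<..<x0}|lborel. r n x * s n x) \<longlonglongrightarrow> (LINT x:{0<..<x0}|lborel. profile x0 x * (- x))"
  proof (rule set_integral_Ioo_bounded_convergence)
    show "\<bar>r n x * s n x\<bar> \<le> x0 * (3 * x0\<^sup>2)" if "n > 0" "x \<in> {0<..<x0}" for n x
      unfolding abs_mult r_def s_def
      using discrete_profile_rate_bound[OF x0 that] discrete_profile_bound[OF x0 that]
        profile_bound[OF that(2)] x0 by (intro mult_mono) auto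
    show "(\<lambda>n. r n x * s n x) \<longlonglongrightarrow> profile x0 x * (- x)" if "x \<in> {0<..<x0}" for x
      unfolding r_def s_def
      by (rule tendsto_eq_intros discrete_profile_tendsto[OF x0 that] refl | simp add: algebra_simps)+
  qed measurable
  moreover have "eventually (\<lambda>n. (LINT x:{0<..<x0}|lborel. r n x * s n x)
      = ((LINT x:{0<..<x0}|lborel. (discrete_profile x0 n x)\<^sup>2)
      - (LINT x:{0<..<x0}|lborel. (profile x0 x)\<^sup>2)) / (x0 / real n)) sequentially"
    using eventually_gt_at_top[of 0]
  proof eventually_elim
    case (elim n)
    have i: "set_integrable lborel {0<..<x0} (\<lambda>x. (discrete_profile x0 n x)\<^sup>2)"
      "set_integrable lborel {0<..<x0} (\<lambda>x. (profile x0 x)\<^sup>2)"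
      unfolding power2_eq_square using discrete_profile_bound[OF x0 elim] profile_bound
      by (intro set_integrable_bounded_mult_Ioo; auto)+
    have "(\<lambda>x. r n x * s n x) = (\<lambda>x. ((discrete_profile x0 n x)\<^sup>2 - (profile x0 x)\<^sup>2) / (x0 / real n))"
      by (auto simp: r_def s_def algebra_simps power2_eq_square diff_divide_distrib add_divide_distrib)
    then show ?case
      by (simp only: set_integral_divide_zero set_integral_diff[OF i])
  qed
  ultimately show ?thesis
    by (rule Lim_transform_eventually)
qed

text \<open>
  The quotient rule for \<open>N\<^sup>h / D\<^sup>h\<close> at \<open>h = 0\<close>. If \<open>g\<close> and \<open>\<kappa>\<close> both vanished, then so would \<open>N\<close>
  and its variation \<open>N'\<close>, two linear equations for \<open>q x0\<close> and \<open>b - zd\<close> with only the zero solution.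
\<close>

lemma g_op_discrete_rate:
  fixes x0 y0 q b zd M1 :: real
  assumes pos: "x0 > 0" "y0 > 0" "M1 > 0" and q: "q \<noteq> 0"
  obtains \<kappa> where
    "(\<lambda>n. (g_op_discrete x0 y0 q b zd M1 n - g_op x0 y0 q b zd M1) / (x0 / real n)) \<longlonglongrightarrow> \<kappa>"
    "g_op x0 y0 q b zd M1 \<noteq> 0 \<or> \<kappa> \<noteq> 0"
proof -
  define c where "c = b - zd"
  define Nh Dh where "Nh n = (LINT x:{0<..<x0}|lborel. discrete_profile x0 n x * (q * x - c))"
    and "Dh n = (LINT x:{0<..<x0}|lborel. (discrete_profile x0 n x)\<^sup>2) + M1 * x0" for n
  define N D where "N = (LINT x:{0<..<x0}|lborel. profile x0 x * (q * x - c))"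
    and "D = (LINT x:{0<..<x0}|lborel. (profile x0 x)\<^sup>2) + M1 * x0"
  define N' where "N' = (LINT x:{0<..<x0}|lborel. - (x / 2) * (q * x - c))"
  define D' where "D' = (LINT x:{0<..<x0}|lborel. profile x0 x * (- x))"
  define \<kappa> where "\<kappa> = (N' - N / D * D') / D"
  have D: "D > 0"
  proof -
    have "(LINT x:{0<..<x0}|lborel. (profile x0 x)\<^sup>2) = 2 / 15 * x0 ^ 5"
      using integral_profile_quadratic[OF pos(1), of 0 1] by simp
    then show ?thesis unfolding D_def using pos by (simp only:) (simp add: add_pos_pos)
  qed
  have h: "(\<lambda>n. x0 / real n) \<longlonglongrightarrow> 0"
    by (intro tendsto_divide_0[OF tendsto_const] filterlim_at_top_imp_at_infinity filterlim_real_sequentially)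
  have N': "(\<lambda>n. (Nh n - N) / (x0 / real n)) \<longlonglongrightarrow> N'"
    unfolding Nh_def N_def N'_def
    by (rule discrete_profile_functional_rate[OF pos(1) _ affine_bound]) auto
  have D': "(\<lambda>n. (Dh n - D) / (x0 / real n)) \<longlonglongrightarrow> D'"
    using discrete_profile_square_rate[OF pos(1)] unfolding Dh_def D_def D'_def by simp
  have "(\<lambda>n. (Dh n - D) / (x0 / real n) * (x0 / real n) + D) \<longlonglongrightarrow> D' * 0 + D"
    by (intro tendsto_intros D' h)
  moreover have "eventually (\<lambda>n. (Dh n - D) / (x0 / real n) * (x0 / real n) + D = Dh n) sequentially"
    using eventually_gt_at_top[of 0] by eventually_elim (use pos in auto)
  ultimately have Dlim: "Dh \<longlonglongrightarrow> D"
    by (simp add: tendsto_cong)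
  have "(\<lambda>n. ((Nh n - N) / (x0 / real n) - N / D * ((Dh n - D) / (x0 / real n))) / Dh n) \<longlonglongrightarrow> \<kappa>"
    unfolding \<kappa>_def using D by (intro tendsto_intros N' D' Dlim) simp
  moreover have "eventually (\<lambda>n. Dh n > 0) sequentially"
    using order_tendstoD(1)[OF Dlim D] .
  then have "eventually (\<lambda>n. ((Nh n - N) / (x0 / real n) - N / D * ((Dh n - D) / (x0 / real n))) / Dh n
      = (g_op_discrete x0 y0 q b zd M1 n - g_op x0 y0 q b zd M1) / (x0 / real n)) sequentially"
    using eventually_gt_at_top[of 0]
  proof eventually_elim
    case (elim n)
    have "g_op_discrete x0 y0 q b zd M1 n = Nh n / Dh n" "g_op x0 y0 q b zd M1 = N / D"
      using g_op_discrete_eq[OF pos elim(2)] g_op_eq[OF pos]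
      by (simp_all add: Nh_def Dh_def N_def D_def c_def)
    then show ?case using D elim pos by (simp add: field_simps)
  qed
  ultimately have lim: "(\<lambda>n. (g_op_discrete x0 y0 q b zd M1 n - g_op x0 y0 q b zd M1) / (x0 / real n)) \<longlonglongrightarrow> \<kappa>"
    by (rule Lim_transform_eventually)
  have "N \<noteq> 0 \<or> N' \<noteq> 0"
  proof (rule ccontr)
    assume "\<not> ?thesis"
    then have "5 / 24 * q * x0 ^ 4 - c * x0 ^ 3 / 3 = 0" "c * x0\<^sup>2 / 4 - q * x0 ^ 3 / 6 = 0"
      using integral_profile_affine[OF pos(1), of q c] integral_linear_affine[OF pos(1), of q c]
      by (simp_all add: N_def N'_def)
    then have "x0 ^ 3 * (5 * (q * x0) - 8 * c) = 0" "x0\<^sup>2 * (3 * c - 2 * (q * x0)) = 0"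
      by (simp_all add: algebra_simps eval_nat_numeral)
    then have "5 * (q * x0) = 8 * c" "3 * c = 2 * (q * x0)"
      using pos by simp_all
    then have "q * x0 = 0" by linarith
    with pos q show False by simp
  qed
  moreover have "g_op x0 y0 q b zd M1 = N / D"
    using g_op_eq[OF pos] by (simp add: N_def D_def c_def)
  ultimately have "g_op x0 y0 q b zd M1 \<noteq> 0 \<or> \<kappa> \<noteq> 0"
    using D by (auto simp: \<kappa>_def)
  with lim show thesis by (rule that)
qed

section \<open>Error of the state\<close>

text \<open>
  The scaled error is \<open>(g \<phi> - \<gamma> \<phi>\<^sup>h) / h = - g (\<phi>\<^sup>h - \<phi>) / h - ((\<gamma> - g) / h) \<phi>\<^sup>h\<close>, and each factor
  on the right is bounded and convergent.
\<close>

lemma H_norm_state_error_tendsto: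
  assumes pos: "x0 > 0" "y0 > 0"
    and \<gamma>: "(\<lambda>n. (\<gamma> n - g) / (x0 / real n)) \<longlonglongrightarrow> \<kappa>"
  shows "(\<lambda>n. H_norm x0 y0 (\<lambda>p. state x0 y0 q b g p - discrete_state x0 q b n (\<gamma> n) p) / (x0 / real n))
    \<longlonglongrightarrow> sqrt (y0 * (LINT x:{0<..<x0}|lborel. (g / 2 * x - \<kappa> * profile x0 x)\<^sup>2))"
proof -
  define k where "k n = (\<gamma> n - g) / (x0 / real n)" for n
  define r where "r n x = (discrete_profile x0 n x - profile x0 x) / (x0 / real n)" for n x
  define f where "f n x = - (g * r n x) - k n * discrete_profile x0 n x" for n x
  obtain K where K: "\<And>n. \<bar>k n\<bar> \<le> K"
    using convergent_imp_Bseq[OF convergentI[OF \<gamma>]] by (auto simp: Bseq_def k_def)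
  have "(\<lambda>n. LINT x:{0<..<x0}|lborel. (f n x)\<^sup>2)
      \<longlonglongrightarrow> (LINT x:{0<..<x0}|lborel. (g / 2 * x - \<kappa> * profile x0 x)\<^sup>2)"
  proof (rule set_integral_Ioo_bounded_convergence)
    show "\<bar>(f n x)\<^sup>2\<bar> \<le> (\<bar>g\<bar> * x0 + K * (2 * x0\<^sup>2))\<^sup>2" if "n > 0" "x \<in> {0<..<x0}" for n x
    proof -
      have "\<bar>g * r n x\<bar> \<le> \<bar>g\<bar> * x0"
        unfolding abs_mult r_def
        using discrete_profile_rate_bound[OF pos(1) that] by (intro mult_left_mono) auto
      moreover have "\<bar>k n * discrete_profile x0 n x\<bar> \<le> K * (2 * x0\<^sup>2)"
        unfolding abs_mult using discrete_profile_bound[OF pos(1) that] K[of n]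
        by (intro mult_mono) auto
      ultimately have "\<bar>f n x\<bar> \<le> \<bar>g\<bar> * x0 + K * (2 * x0\<^sup>2)"
        unfolding f_def by linarith
      from power_mono[OF this abs_ge_zero, of 2] show ?thesis by simp
    qed
    show "(\<lambda>n. (f n x)\<^sup>2) \<longlonglongrightarrow> (g / 2 * x - \<kappa> * profile x0 x)\<^sup>2" if "x \<in> {0<..<x0}" for x
    proof -
      have "(\<lambda>n. (f n x)\<^sup>2) \<longlonglongrightarrow> (- (g * - (x / 2)) - \<kappa> * profile x0 x)\<^sup>2"
        unfolding f_def r_def k_def
        by (intro tendsto_intros \<gamma> discrete_profile_tendsto[OF pos(1) that])
      then show ?thesis by simp
    qed
  qed (unfold f_def r_def, measurable)
  then have "(\<lambda>n. sqrt (y0 * (LINT x:{0<..<x0}|lborel. (f n x)\<^sup>2)))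
      \<longlonglongrightarrow> sqrt (y0 * (LINT x:{0<..<x0}|lborel. (g / 2 * x - \<kappa> * profile x0 x)\<^sup>2))"
    by (intro tendsto_intros)
  moreover have "eventually (\<lambda>n. sqrt (y0 * (LINT x:{0<..<x0}|lborel. (f n x)\<^sup>2)) =
      H_norm x0 y0 (\<lambda>p. state x0 y0 q b g p - discrete_state x0 q b n (\<gamma> n) p) / (x0 / real n)) sequentially"
    using eventually_gt_at_top[of 0]
  proof eventually_elim
    case (elim n)
    let ?h = "x0 / real n"
    have h: "?h > 0" using elim pos by simp
    have "H_norm x0 y0 (\<lambda>p. state x0 y0 q b g p - discrete_state x0 q b n (\<gamma> n) p)
      = sqrt (y0 * (LINT x:{0<..<x0}|lborel. (?h * f n x)\<^sup>2))"
    proof (rule H_norm_x'[OF pos])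
      show "state x0 y0 q b g (x, y) - discrete_state x0 q b n (\<gamma> n) (x, y) = ?h * f n x"
        if "x \<in> {0<..<x0}" "y \<in> {0<..<y0}" for x y
        using that pos elim h
        by (simp add: state_profile discrete_state_profile f_def r_def k_def) (simp add: field_simps)
    qed (unfold f_def r_def, measurable)
    also have "\<dots> = ?h * sqrt (y0 * (LINT x:{0<..<x0}|lborel. (f n x)\<^sup>2))"
      unfolding power_mult_distrib set_integral_mult_right mult.left_commute[of y0] real_sqrt_mult[of "?h\<^sup>2"]
      using h pos by simp
    finally show ?case using h by (metis nonzero_mult_div_cancel_left less_irrefl)
  qed
  ultimately show ?thesis by (rule Lim_transform_eventually)
qed

section \<open>Error of the derivative\<close>

lemma partial_x_state:
  assumes "x \<in> {0<..<x0}" "y \<in> {0<..<y0}"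
  shows "partial_x (state x0 y0 q b g) (x, y) = g * (x0 - x) - q"
proof -
  have "eventually (\<lambda>t. t \<in> {0<..<x0}) (nhds x)"
    using assms by (intro eventually_nhds_in_open) auto
  then have "eventually (\<lambda>t. state x0 y0 q b g (t, y) = g * (x0 * t - t\<^sup>2 / 2) - q * t + b) (nhds x)"
    by eventually_elim (use assms in \<open>auto simp: state_profile profile_def\<close>)
  from deriv_cong_ev[OF this refl]
  have "partial_x (state x0 y0 q b g) (x, y) = deriv (\<lambda>t. g * (x0 * t - t\<^sup>2 / 2) - q * t + b) x"
    by (simp add: partial_x_def)
  also have "\<dots> = g * (x0 - x) - q"
    by (intro DERIV_imp_deriv) (auto intro!: derivative_eq_intros)
  finally show ?thesis .
qed

lemma partial_x_discrete_state:
  assumes "x0 > 0" "n > 0" "x \<in> {0<..<x0}" and node: "x \<notin> (\<lambda>i. real i * (x0 / real n)) ` {1..n}"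
  shows "partial_x (discrete_state x0 q b n g) (x, y)
    = g * (x0 - x0 / real n * of_int \<lceil>x / (x0 / real n)\<rceil>) - q"
proof -
  define h where "h = x0 / real n"
  obtain i where i: "i \<in> {1..n}" "\<lceil>x / h\<rceil> = int i" "(real i - 1) * h < x" "x \<le> real i * h"
    using cell_of_point[OF assms(1-3)] unfolding h_def .
  have "x \<noteq> real i * h" using node i(1) by (auto simp: h_def)
  then have "eventually (\<lambda>t. t \<in> {(real i - 1) * h<..<real i * h}) (nhds x)"
    using i by (intro eventually_nhds_in_open) auto
  then have "eventually (\<lambda>t. discrete_state x0 q b n g (t, y) =
      (g * x0 - q - h * g * real i) * t + h\<^sup>2 * g * (real i * (real i - 1) / 2) + b) (nhds x)"
    by eventually_elim (rule discrete_state_eq[OF assms(1) i(1) h_def], auto)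
  from deriv_cong_ev[OF this refl]
  have "partial_x (discrete_state x0 q b n g) (x, y)
    = deriv (\<lambda>t. (g * x0 - q - h * g * real i) * t + h\<^sup>2 * g * (real i * (real i - 1) / 2) + b) x"
    by (simp add: partial_x_def)
  also have "\<dots> = g * x0 - q - h * g * real i"
    by (intro DERIV_imp_deriv) (auto intro!: derivative_eq_intros)
  finally show ?thesis
    by (simp add: i(2) h_def[symmetric] algebra_simps)
qed

text \<open>
  On each cell the integrand is \<open>(g s - \<beta>)\<^sup>2\<close> with \<open>s\<close> running from \<open>h\<close> down to \<open>0\<close> and \<open>\<beta>\<close> constant;
  the constants are \<open>\<delta> h (n - i)\<close>, so the sum needs only the first two power sums.
\<close>

lemma integral_gradient_error:
  fixes x0 g \<delta> :: real
  assumes x0: "x0 > 0" and n: "n > 0" and h: "h = x0 / real n"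
  shows "(LINT x:{0<..<x0}|lborel. (g * (h * of_int \<lceil>x / h\<rceil> - x) - \<delta> * (x0 - h * of_int \<lceil>x / h\<rceil>))\<^sup>2)
    = h ^ 3 * (real n * g\<^sup>2 / 3 - g * \<delta> * (real n * (real n - 1) / 2)
        + \<delta>\<^sup>2 * (real n * (real n - 1) * (2 * real n - 1) / 6))"
proof -
  define f where "f x = (g * (h * of_int \<lceil>x / h\<rceil> - x) - \<delta> * (x0 - h * of_int \<lceil>x / h\<rceil>))" for x
  have hp: "h > 0" and nh: "real n * h = x0" using x0 n h by auto
  have [measurable]: "f \<in> borel_measurable borel" unfolding f_def by measurable
  have bound: "\<bar>f x\<bar> \<le> \<bar>g\<bar> * x0 + \<bar>\<delta>\<bar> * x0" if x: "x \<in> {0<..<x0}" for x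
  proof -
    obtain i where i: "i \<in> {1..n}" "\<lceil>x / h\<rceil> = int i" "(real i - 1) * h < x" "x \<le> real i * h"
      using cell_of_point[OF x0 n x] unfolding h .
    have "1 * h \<le> real i * h" "real i * h \<le> real n * h" using i(1) hp by (auto intro: mult_right_mono)
    with i x nh have "\<bar>h * real i - x\<bar> \<le> x0" "\<bar>x0 - h * real i\<bar> \<le> x0"
      using hp by (auto simp: algebra_simps)
    then have "\<bar>g * (h * real i - x)\<bar> \<le> \<bar>g\<bar> * x0" "\<bar>\<delta> * (x0 - h * real i)\<bar> \<le> \<bar>\<delta>\<bar> * x0"
      unfolding abs_mult by (auto intro: mult_left_mono)
    then show ?thesis unfolding f_def i(2) by simp
  qed
  have int: "set_integrable lborel {0<..<real n * h} (\<lambda>x. (f x)\<^sup>2)"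
    unfolding power2_eq_square nh by (rule set_integrable_bounded_mult_Ioo[OF _ _ bound bound]) auto
  have cell: "(LINT x:{real i * h<..<real (Suc i) * h}|lborel. (f x)\<^sup>2)
      = h ^ 3 * (g\<^sup>2 / 3 - g * \<delta> * real (n - Suc i) + \<delta>\<^sup>2 * (real (n - Suc i))\<^sup>2)" if "i < n" for i
  proof -
    \<comment> \<open>\<open>F\<close> is written as a polynomial rather than as \<open>- (g (c - x) - \<beta>)\<^sup>3 / (3 g)\<close> to cover \<open>g = 0\<close>.\<close>
    define c where "c = real (Suc i) * h"
    define \<beta> where "\<beta> = \<delta> * (x0 - c)"
    define F where "F x = - (g\<^sup>2 * (c - x) ^ 3 / 3 - g * \<beta> * (c - x)\<^sup>2 + \<beta>\<^sup>2 * (c - x))" for x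
    have "f x = g * (c - x) - \<beta>" if "x \<in> {real i * h<..<real (Suc i) * h}" for x
    proof -
      have "\<lceil>x / h\<rceil> = int (Suc i)"
        using that hp by (intro ceiling_unique) (auto simp: field_simps)
      then show ?thesis by (simp add: f_def c_def \<beta>_def mult.commute)
    qed
    then have "(LINT x:{real i * h<..<real (Suc i) * h}|lborel. (f x)\<^sup>2)
      = (LINT x:{real i * h<..<real (Suc i) * h}|lborel. (g * (c - x) - \<beta>)\<^sup>2)"
      by (intro set_lebesgue_integral_cong) auto
    also have "\<dots> = F (real (Suc i) * h) - F (real i * h)"
      using hp
      by (intro set_integral_Ioo_FTC) (auto simp: F_def intro!: continuous_intros derivative_eq_intros,
          simp_all add: field_simps power2_eq_square)
    also have "\<dots> = g\<^sup>2 * h ^ 3 / 3 - g * \<beta> * h\<^sup>2 + \<beta>\<^sup>2 * h"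
      by (simp add: F_def c_def algebra_simps)
    also have "\<beta> = \<delta> * h * real (n - Suc i)"
      using that by (simp add: \<beta>_def c_def nh[symmetric] of_nat_diff algebra_simps)
    finally show ?thesis by (simp add: algebra_simps power2_eq_square power3_eq_cube)
  qed
  have s1: "(\<Sum>i<n. real (n - Suc i)) = real n * (real n - 1) / 2"
    unfolding sum.nat_diff_reindex[of real n] by (induction n) (auto simp: field_simps)
  have s2: "(\<Sum>i<n. (real (n - Suc i))\<^sup>2) = real n * (real n - 1) * (2 * real n - 1) / 6"
    unfolding sum.nat_diff_reindex[of "\<lambda>i. (real i)\<^sup>2" n]
    by (induction n) (auto simp: field_simps power2_eq_square)
  have "(LINT x:{0<..<x0}|lborel. (f x)\<^sup>2)
      = (\<Sum>i<n. h ^ 3 * (g\<^sup>2 / 3 - g * \<delta> * real (n - Suc i) + \<delta>\<^sup>2 * (real (n - Suc i))\<^sup>2))"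
    unfolding set_integral_Ioo_cells[OF less_imp_le[OF hp] int, unfolded nh]
    by (intro sum.cong refl cell) auto
  also have "\<dots> = h ^ 3 * (real n * (g\<^sup>2 / 3) - g * \<delta> * (\<Sum>i<n. real (n - Suc i)) + \<delta>\<^sup>2 * (\<Sum>i<n. (real (n - Suc i))\<^sup>2))"
    by (simp add: sum_distrib_left[symmetric] sum.distrib sum_subtractf)
  finally show ?thesis unfolding s1 s2 f_def by simp
qed

lemma H_norm_gradient_error_tendsto:
  assumes pos: "x0 > 0" "y0 > 0"
    and \<gamma>: "(\<lambda>n. (\<gamma> n - g) / (x0 / real n)) \<longlonglongrightarrow> \<kappa>"
  shows "(\<lambda>n. H_norm x0 y0 (\<lambda>p. partial_x (state x0 y0 q b g) p
        - partial_x (discrete_state x0 q b n (\<gamma> n)) p) / (x0 / real n))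
    \<longlonglongrightarrow> sqrt (y0 * (g\<^sup>2 * x0 / 3 - g * \<kappa> * x0\<^sup>2 / 2 + \<kappa>\<^sup>2 * x0 ^ 3 / 3))"
proof -
  define k where "k n = (\<gamma> n - g) / (x0 / real n)" for n
  define S where "S n = g\<^sup>2 * x0 / 3 - g * k n * x0\<^sup>2 * (1 - 1 / real n) / 2
      + (k n)\<^sup>2 * x0 ^ 3 * ((1 - 1 / real n) * (2 - 1 / real n)) / 6" for n
  have inv: "(\<lambda>n. 1 / real n) \<longlonglongrightarrow> 0" by (rule lim_1_over_n)
  have "S \<longlonglongrightarrow> g\<^sup>2 * x0 / 3 - g * \<kappa> * x0\<^sup>2 * (1 - 0) / 2 + \<kappa>\<^sup>2 * x0 ^ 3 * ((1 - 0) * (2 - 0)) / 6"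
    unfolding S_def k_def by (intro tendsto_intros \<gamma> inv) auto
  then have "(\<lambda>n. sqrt (y0 * S n)) \<longlonglongrightarrow> sqrt (y0 * (g\<^sup>2 * x0 / 3 - g * \<kappa> * x0\<^sup>2 * (1 - 0) / 2 + \<kappa>\<^sup>2 * x0 ^ 3 * ((1 - 0) * (2 - 0)) / 6))"
    by (intro tendsto_intros)
  moreover have "eventually (\<lambda>n. sqrt (y0 * S n) = H_norm x0 y0 (\<lambda>p. partial_x (state x0 y0 q b g) p
        - partial_x (discrete_state x0 q b n (\<gamma> n)) p) / (x0 / real n)) sequentially"
    using eventually_gt_at_top[of 0]
  proof eventually_elim
    case (elim n)
    define h where "h = x0 / real n"
    have h: "h > 0" using elim pos by (simp add: h_def)
    have kh: "\<gamma> n - g = k n * h" using h by (simp add: k_def h_def[symmetric])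
    let ?f = "\<lambda>x. g * (h * of_int \<lceil>x / h\<rceil> - x) - (\<gamma> n - g) * (x0 - h * of_int \<lceil>x / h\<rceil>)"
    have "H_norm x0 y0 (\<lambda>p. partial_x (state x0 y0 q b g) p - partial_x (discrete_state x0 q b n (\<gamma> n)) p)
      = sqrt (y0 * (LINT x:{0<..<x0}|lborel. (?f x)\<^sup>2))"
    proof (rule H_norm_x[OF pos])
      show "finite ((\<lambda>i. real i * (x0 / real n)) ` {1..n})" by simp
      \<comment> \<open>The discrete state does not depend on \<open>y\<close>, so neither does its derivative, even at a node.\<close>
      show "partial_x (state x0 y0 q b g) (x, y) - partial_x (discrete_state x0 q b n (\<gamma> n)) (x, y)
          = g * (x0 - x) - q - partial_x (discrete_state x0 q b n (\<gamma> n)) (x, 0)"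
        if "x \<in> {0<..<x0}" "y \<in> {0<..<y0}" for x y
        using that by (simp add: partial_x_state) (simp add: partial_x_def discrete_state_def)
      show "g * (x0 - x) - q - partial_x (discrete_state x0 q b n (\<gamma> n)) (x, 0) = ?f x"
        if "x \<in> {0<..<x0}" "x \<notin> (\<lambda>i. real i * (x0 / real n)) ` {1..n}" for x
        using partial_x_discrete_state[OF pos(1) elim that, of q b "\<gamma> n" 0] by (simp add: h_def[symmetric] algebra_simps)
    qed measurable
    also have "(LINT x:{0<..<x0}|lborel. (?f x)\<^sup>2) = h\<^sup>2 * S n"
      unfolding integral_gradient_error[OF pos(1) elim h_def] kh
      using elim by (simp add: S_def h_def field_simps eval_nat_numeral)
    also have "sqrt (y0 * (h\<^sup>2 * S n)) = h * sqrt (y0 * S n)"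
      using h by (simp add: real_sqrt_mult)
    finally show ?case using h by (simp add: h_def[symmetric])
  qed
  ultimately show ?thesis
    by (simp add: Lim_transform_eventually)
qed

lemma smallo_of_ratio_tendsto:
  assumes "x0 > 0" and "(\<lambda>n. f n / (x0 / real n)) \<longlonglongrightarrow> C"
  shows "(\<lambda>n. f n - C * (x0 / real n)) \<in> o[sequentially](\<lambda>n. x0 / real n)"
proof (rule smalloI_tendsto)
  have ev: "eventually (\<lambda>n. x0 / real n \<noteq> 0) sequentially"
    using eventually_gt_at_top[of 0] by eventually_elim (use assms in auto)
  then show "eventually (\<lambda>n. x0 / real n \<noteq> 0) sequentially" .
  have "(\<lambda>n. f n / (x0 / real n) - C) \<longlonglongrightarrow> C - C"
    by (intro tendsto_intros assms)
  moreover have "eventually (\<lambda>n. f n / (x0 / real n) - C = (f n - C * (x0 / real n)) / (x0 / real n)) sequentially"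
    using ev by eventually_elim (subst diff_divide_distrib, subst nonzero_mult_div_cancel_right, auto)
  ultimately show "(\<lambda>n. (f n - C * (x0 / real n)) / (x0 / real n)) \<longlonglongrightarrow> 0"
    by (simp add: Lim_transform_eventually)
qed

section \<open>Asymptotics of the errors at the optimum\<close>

theorem lemma5:
  fixes x0 y0 q b zd M1 :: real
  assumes "x0 > 0" and "y0 > 0" and "q \<noteq> 0" and "M1 > 0"
  shows "\<exists>C5 C6 :: real. C5 > 0 \<and> C6 > 0 \<and>
    (\<lambda>n. H_norm x0 y0 (\<lambda>p.
        state x0 y0 q b (g_op x0 y0 q b zd M1) p
        - discrete_state x0 q b n (g_op_discrete x0 y0 q b zd M1 n) p)
      - C5 * (x0 / real n)) \<in> o[sequentially](\<lambda>n. x0 / real n) \<and>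
    (\<lambda>n. H_norm x0 y0 (\<lambda>p.
        partial_x (state x0 y0 q b (g_op x0 y0 q b zd M1)) p
        - partial_x (discrete_state x0 q b n (g_op_discrete x0 y0 q b zd M1 n)) p)
      - C6 * (x0 / real n)) \<in> o[sequentially](\<lambda>n. x0 / real n)"
proof -
  define g where "g = g_op x0 y0 q b zd M1"
  obtain \<kappa> where \<kappa>: "(\<lambda>n. (g_op_discrete x0 y0 q b zd M1 n - g) / (x0 / real n)) \<longlonglongrightarrow> \<kappa>"
    and nz: "g \<noteq> 0 \<or> \<kappa> * x0 \<noteq> 0"
    using g_op_discrete_rate[OF assms(1,2,4,3), of b zd] assms(1) unfolding g_def by (metis mult_eq_0_iff less_irrefl)
  let ?A = "LINT x:{0<..<x0}|lborel. (g / 2 * x - \<kappa> * profile x0 x)\<^sup>2"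
  let ?B = "g\<^sup>2 * x0 / 3 - g * \<kappa> * x0\<^sup>2 / 2 + \<kappa>\<^sup>2 * x0 ^ 3 / 3"
  \<comment> \<open>Both squared limits are brought into this form by completing the square; scaling \<open>\<kappa>\<close> by \<open>x0\<close> makes
      them homogeneous.\<close>
  have pos: "u * (s - t * (\<kappa> * x0))\<^sup>2 + w * (\<kappa> * x0)\<^sup>2 > 0" if "s = 0 \<longleftrightarrow> g = 0" "u > 0" "w > 0" for s t u w
    using nz that by (cases "\<kappa> * x0 = 0") (auto intro: add_nonneg_pos)
  have "?A = x0 ^ 3 * (1 / 3 * (g / 2 - 5 / 8 * (\<kappa> * x0))\<^sup>2 + (2 / 15 - 25 / 192) * (\<kappa> * x0)\<^sup>2)"
    unfolding integral_profile_quadratic[OF assms(1)]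
    by (simp add: field_simps eval_nat_numeral)
  then have A: "?A > 0"
    using pos[of "g / 2" "1 / 3" "2 / 15 - 25 / 192" "5 / 8"] assms(1) by simp
  have "?B = x0 * (1 / 3 * (g - 3 / 4 * (\<kappa> * x0))\<^sup>2 + (1 / 3 - 3 / 16) * (\<kappa> * x0)\<^sup>2)"
    by (simp add: field_simps eval_nat_numeral)
  then have B: "?B > 0"
    using pos[of g "1 / 3" "1 / 3 - 3 / 16" "3 / 4"] assms(1) by simp
  show ?thesis
    unfolding g_def[symmetric]
  proof (intro exI conjI)
    show "sqrt (y0 * ?A) > 0" "sqrt (y0 * ?B) > 0" using A B assms(2) by simp_all
  qed (rule smallo_of_ratio_tendsto[OF assms(1)] H_norm_state_error_tendsto[OF assms(1,2) \<kappa>]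
      H_norm_gradient_error_tendsto[OF assms(1,2) \<kappa>])+
qed

end
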